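(* Suppose that for every integer $n\ge 2$ and every finite $n$-BFC-group $H$ with trivial centre one has $|H|\le n^2-n$. Then for every finite group $G$ that is perfect (i.e. $G'=G$) and has trivial centre, one has $|G|\le n^2$, where $n$ is the maximum size of a conjugacy class of $G$.
   Context: A group is called an $n$-BFC-group if each of its conjugacy classes is finite and contains at most $n$ elements. *)

theory Defs
  imports "HOL-Algebra.Group_Action" "HOL-Algebra.Generated_Groups"
begin

definition conjugacy_classes :: "('a, 'b) monoid_scheme \<Rightarrow> 'a set set" where
  "conjugacy_classes G =
     orbits G (carrier G) (\<lambda>g. \<lambda>h \<in> carrier G. g \<otimes>\<^bsub>G\<^esub> h \<otimes>\<^bsub>G\<^esub> inv\<^bsub>G\<^esub> g)"

definition BFC_group :: "nat \<Rightarrow> ('a, 'b) monoid_scheme \<Rightarrow> bool" where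
  "BFC_group n G \<longleftrightarrow> group G \<and> (\<forall>C \<in> conjugacy_classes G. finite C \<and> card C \<le> n)"

definition group_centre :: "('a, 'b) monoid_scheme \<Rightarrow> 'a set" where
  "group_centre G = {z \<in> carrier G. \<forall>g \<in> carrier G. g \<otimes>\<^bsub>G\<^esub> z = z \<otimes>\<^bsub>G\<^esub> g}"

definition perfect_group :: "('a, 'b) monoid_scheme \<Rightarrow> bool" where
  "perfect_group G \<longleftrightarrow> group G \<and> derived G (carrier G) = carrier G"

definition max_class_size :: "('a, 'b) monoid_scheme \<Rightarrow> nat" where
  "max_class_size G = Max (card ` conjugacy_classes G)"

text \<open>
  HOL cannot quantify over types inside a formula. A statement about all finite groups that occurs
  as a hypothesis is therefore taken over groups with carrier in \<^typ>\<open>nat\<close>. This loses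
  nothing: every finite group is isomorphic to such a group, and order, class sizes and triviality
  of the centre are invariant under isomorphism.
\<close>

end

theory Submission
  imports Defs "HOL-Algebra.Weak_Morphisms"
begin

text \<open>
  By the choice of \<open>n\<close> as the largest class size, the group is an
  \<open>n\<close>-BFC-group with trivial centre. For \<open>n \<ge> 2\<close> the assumed bound
  \<open>n\<^sup>2 - n\<close> applies and is stronger than the claim. In the remaining case all
  classes are singletons, so every element is central, the group is trivial, and the claim is
  \<open>1 \<le> n\<^sup>2\<close>. Here \<open>n\<close> cannot be \<open>0\<close>, because every element lies
  in its own class (\<open>BFC_group_pos\<close>).

  The assumed bound speaks about groups of natural numbers, so the group is first transported along
  an injection of its finite carrier into \<^typ>\<open>nat\<close>. An isomorphism maps conjugacy
  classes onto conjugacy classes (\<open>conjugacy_classes_iso\<close>) and the centre onto the centre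
  (\<open>group_centre_iso\<close>), so the hypotheses and the order survive the transport.
\<close>

definition conjugacy_class :: "('a, 'b) monoid_scheme \<Rightarrow> 'a \<Rightarrow> 'a set" where
  "conjugacy_class G x = (\<lambda>g. g \<otimes>\<^bsub>G\<^esub> x \<otimes>\<^bsub>G\<^esub> inv\<^bsub>G\<^esub> g) ` carrier G"

lemma conjugacy_classes_eq_image:
  "conjugacy_classes G = conjugacy_class G ` carrier G"
  unfolding conjugacy_classes_def orbits_def orbit_def conjugacy_class_def
  by (auto simp: image_def)

lemma (in group) self_in_conjugacy_class:
  assumes "x \<in> carrier G"
  shows "x \<in> conjugacy_class G x"
  unfolding conjugacy_class_def using assms by (intro image_eqI[of _ _ \<one>]) auto

text \<open>
  A singleton class contains only its representative \<open>x\<close>, so conjugating \<open>x\<close> by any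
  element gives back \<open>x\<close>: this is commutation with that element.
\<close>

lemma (in group) conjugacy_class_singleton_imp_central:
  assumes "x \<in> carrier G" "conjugacy_class G x \<subseteq> {x}"
  shows "x \<in> group_centre G"
proof -
  have "g \<otimes> x = x \<otimes> g" if g: "g \<in> carrier G" for g
  proof -
    have "g \<otimes> x \<otimes> inv g = x"
      using assms(2) g by (auto simp: conjugacy_class_def)
    then show ?thesis
      using assms(1) g by (metis inv_solve_right' m_closed)
  qed
  then show ?thesis
    using assms(1) by (simp add: group_centre_def)
qed

lemma conjugacy_class_hom_image:
  assumes "group_hom G H h" "h ` carrier G = carrier H" "x \<in> carrier G"
  shows "conjugacy_class H (h x) = h ` conjugacy_class G x"
proof -
  interpret group_hom G H h by fact
  show ?thesis
    unfolding conjugacy_class_def assms(2)[symmetric] image_image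
    using assms(3) by (intro image_cong) simp_all
qed

lemma conjugacy_classes_iso:
  assumes "group G" "group H" "h \<in> iso G H"
  shows "conjugacy_classes H = (`) h ` conjugacy_classes G"
proof -
  have hom: "group_hom G H h" and onto: "h ` carrier G = carrier H"
    using assms by (auto simp: group_hom_def group_hom_axioms_def iso_def bij_betw_def)
  show ?thesis
    unfolding conjugacy_classes_eq_image onto[symmetric] image_image
    using conjugacy_class_hom_image[OF hom onto] by (intro image_cong) simp_all
qed

lemma group_centre_iso:
  assumes "group G" "h \<in> iso G H"
  shows "group_centre H = h ` group_centre G"
proof -
  interpret group G by fact
  have hom: "h (x \<otimes>\<^bsub>G\<^esub> y) = h x \<otimes>\<^bsub>H\<^esub> h y" if "x \<in> carrier G" "y \<in> carrier G" for x y
    using assms(2) that by (auto simp: iso_def hom_def)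
  have inj: "inj_on h (carrier G)" and onto: "carrier H = h ` carrier G"
    using assms(2) by (auto simp: iso_def bij_betw_def)
  have "h g \<otimes>\<^bsub>H\<^esub> h z = h z \<otimes>\<^bsub>H\<^esub> h g \<longleftrightarrow> g \<otimes>\<^bsub>G\<^esub> z = z \<otimes>\<^bsub>G\<^esub> g"
    if "g \<in> carrier G" "z \<in> carrier G" for g z
    using that inj by (simp add: hom[symmetric] inj_on_eq_iff)
  then show ?thesis
    unfolding group_centre_def onto by auto
qed

lemma finite_group_iso_nat_group:
  assumes "group G" "finite (carrier G)"
  obtains H :: "nat monoid" and h where "group H" "h \<in> iso G H"
proof -
  interpret group G by fact
  obtain h :: "_ \<Rightarrow> nat" where inj: "inj_on h (carrier G)"
    using finite_imp_inj_to_nat_seg[OF assms(2)] by blast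
  show thesis
    using that inj_imp_image_group_is_group[OF inj] inj_imp_image_group_iso[OF inj] by blast
qed

text \<open>
  \<^const>\<open>Max\<close> has its intended meaning only on finite sets. A finite group has finitely
  many classes, so here it does bound every class size.
\<close>

lemma finite_group_BFC_max_class_size:
  assumes "group G" "finite (carrier G)"
  shows "BFC_group (max_class_size G) G"
  using assms
  by (auto simp: BFC_group_def max_class_size_def conjugacy_classes_eq_image conjugacy_class_def)

lemma BFC_group_iso:
  assumes "group H" "h \<in> iso G H" "BFC_group n G"
  shows "BFC_group n H"
  using assms conjugacy_classes_iso[of G H h]
  by (auto simp: BFC_group_def intro: order_trans[OF card_image_le])

lemma (in group) BFC_group_pos:
  assumes "BFC_group n G"
  shows "n \<ge> 1"
proof -
  have "finite (conjugacy_class G \<one>)" "card (conjugacy_class G \<one>) \<le> n"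
    using assms by (auto simp: BFC_group_def conjugacy_classes_eq_image)
  moreover have "card (conjugacy_class G \<one>) > 0"
    using self_in_conjugacy_class[OF one_closed] calculation(1) by (auto simp: card_gt_0_iff)
  ultimately show ?thesis
    by linarith
qed

lemma (in group) BFC_group_1_imp_centre_eq_carrier:
  assumes "BFC_group 1 G"
  shows "group_centre G = carrier G"
proof -
  have "x \<in> group_centre G" if x: "x \<in> carrier G" for x
  proof (rule conjugacy_class_singleton_imp_central[OF x])
    have "finite (conjugacy_class G x)" "card (conjugacy_class G x) \<le> Suc 0"
      using assms x by (auto simp: BFC_group_def conjugacy_classes_eq_image)
    then show "conjugacy_class G x \<subseteq> {x}"
      using self_in_conjugacy_class[OF x] by (auto simp: card_le_Suc0_iff_eq)
  qed
  then show ?thesis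
    by (auto simp: group_centre_def)
qed

theorem corollary7:
  fixes G :: "('a, 'b) monoid_scheme" and n :: nat
  assumes "\<And>(n :: nat) (H :: nat monoid).
      \<lbrakk>n \<ge> 2; BFC_group n H; finite (carrier H); group_centre H = {\<one>\<^bsub>H\<^esub>}\<rbrakk>
        \<Longrightarrow> order H \<le> n\<^sup>2 - n"
    and "group G"
    and "finite (carrier G)"
    and "perfect_group G"
    and "group_centre G = {\<one>\<^bsub>G\<^esub>}"
    and "n = max_class_size G"
  shows "order G \<le> n\<^sup>2"
proof (cases "n \<ge> 2")
  case True
  obtain H :: "nat monoid" and h where H: "group H" and h: "h \<in> iso G H"
    using finite_group_iso_nat_group[OF assms(2,3)] .
  have bij: "bij_betw h (carrier G) (carrier H)" and hom: "h \<in> hom G H"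
    using h by (auto simp: iso_def)
  have BFC: "BFC_group n H"
    using BFC_group_iso[OF H h] finite_group_BFC_max_class_size[OF assms(2,3)] assms(6) by simp
  have fin: "finite (carrier H)"
    using bij assms(3) by (simp add: bij_betw_finite)
  have centre: "group_centre H = {\<one>\<^bsub>H\<^esub>}"
    using group_centre_iso[OF assms(2) h] assms(5) hom_one[OF hom assms(2) H] by simp
  have "order G = order H"
    using bij by (simp add: order_def bij_betw_same_card)
  also have "\<dots> \<le> n\<^sup>2 - n"
    using assms(1)[OF True BFC fin centre] .
  finally show ?thesis
    by simp
next
  case False
  interpret group G by fact
  have BFC: "BFC_group n G"
    using finite_group_BFC_max_class_size[OF assms(2,3)] assms(6) by simp
  with False have "n = 1"
    using BFC_group_pos[OF BFC] by linarith
  moreover from this have "carrier G = {\<one>\<^bsub>G\<^esub>}"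
    using BFC_group_1_imp_centre_eq_carrier BFC assms(5) by simp
  ultimately show ?thesis
    by (simp add: order_def)
qed

end
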